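(* $\displaystyle\liminf_{A\to\infty}\frac{\#\mathbb{L}^{\mathrm{loc}}(A)}{\#\mathbb{L}(A)}>0.$
   Context: For $\mathbf{x}\in\mathbb{R}^4$ let $\|\mathbf{x}\|$ be the Euclidean norm. Let $\mathbb{Z}^4_{\mathrm{prim}}$ be the set of tuples $\mathbf{a}=(a_1,\dots,a_4)$ of non-zero integers with $\gcd(a_1,a_2,a_3,a_4)=1$, and $\mathbb{L}(A)=\{\mathbf{a}\in\mathbb{Z}^4_{\mathrm{prim}}:\|\mathbf{a}\|\leq A\}$. A tuple $\mathbf{a}\in\mathbb{Z}^4_{\mathrm{prim}}$ is locally solvable if its coordinates are not all of the same sign and for every prime $p$ there exist integers $x_1,\dots,x_4$, none divisible by $p$, with $a_1x_1+\dots+a_4x_4\equiv 0\pmod p$. $\mathbb{L}^{\mathrm{loc}}(A)$ is the set of locally solvable $\mathbf{a}\in\mathbb{Z}^4_{\mathrm{prim}}$ with $\|\mathbf{a}\|\leq A$. *)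

theory Defs
  imports "HOL-Analysis.Analysis" "HOL-Number_Theory.Number_Theory"
begin

(* Unlike the usual convention for primitive vectors, every coordinate is required to be nonzero. *)
definition Z4prim :: "(int ^ 4) set" where
  "Z4prim = {a. (\<forall>i. a $ i \<noteq> 0) \<and> (GCD i. a $ i) = 1}"

definition real_vec :: "int ^ 4 \<Rightarrow> real ^ 4" where
  "real_vec a = (\<chi> i. real_of_int (a $ i))"

definition L :: "real \<Rightarrow> (int ^ 4) set" where
  "L A = {a \<in> Z4prim. norm (real_vec a) \<le> A}"

definition locally_solvable :: "int ^ 4 \<Rightarrow> bool" where
  "locally_solvable a \<longleftrightarrow>
     \<not> ((\<forall>i. a $ i > 0) \<or> (\<forall>i. a $ i < 0)) \<and>
     (\<forall>p::int. prime p \<longrightarrow>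
        (\<exists>x :: int ^ 4. (\<forall>i. \<not> p dvd x $ i) \<and> [(\<Sum>i\<in>UNIV. a $ i * x $ i) = 0] (mod p)))"

definition Lloc :: "real \<Rightarrow> (int ^ 4) set" where
  "Lloc A = {a \<in> Z4prim. locally_solvable a \<and> norm (real_vec a) \<le> A}"

(* The cardinalities used in the density are those of genuinely finite sets. *)
lemma finite_L: "finite (L A)"
proof -
  have "L A \<subseteq> {a. \<forall>i. a $ i \<in> {-\<lfloor>A\<rfloor>..\<lfloor>A\<rfloor>}}"
  proof (intro subsetI CollectI allI)
    fix a :: "int ^ 4" and i :: 4
    assume "a \<in> L A"
    moreover have "\<bar>real_vec a $ i\<bar> \<le> norm (real_vec a)"
      by (rule component_le_norm_cart)
    ultimately have "\<bar>real_of_int (a $ i)\<bar> \<le> A"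
      by (simp add: L_def real_vec_def)
    then have "a $ i \<le> \<lfloor>A\<rfloor>" "- (a $ i) \<le> \<lfloor>A\<rfloor>"
      by (simp_all add: le_floor_iff)
    then show "a $ i \<in> {-\<lfloor>A\<rfloor>..\<lfloor>A\<rfloor>}"
      by simp
  qed
  moreover have "finite {a :: int ^ 4. \<forall>i. a $ i \<in> {-\<lfloor>A\<rfloor>..\<lfloor>A\<rfloor>}}"
  proof (rule finite_imageD)
    show "finite (vec_nth ` {a :: int ^ 4. \<forall>i. a $ i \<in> {-\<lfloor>A\<rfloor>..\<lfloor>A\<rfloor>}})"
      by (rule finite_subset[OF _ finite_PiE[of UNIV "\<lambda>_. {-\<lfloor>A\<rfloor>..\<lfloor>A\<rfloor>}"]]) (auto simp: PiE_def)
    show "inj_on vec_nth {a :: int ^ 4. \<forall>i. a $ i \<in> {-\<lfloor>A\<rfloor>..\<lfloor>A\<rfloor>}}"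
      by (auto simp: inj_on_def vec_eq_iff)
  qed
  ultimately show ?thesis
    by (rule finite_subset)
qed

lemma Lloc_subset_L: "Lloc A \<subseteq> L A"
  by (auto simp: Lloc_def L_def)

end

theory Submission imports Defs
begin

text \<open>
  A prime \<open>p \<ge> 3\<close> is no obstruction as soon as two of the coordinates are units modulo \<open>p\<close>.
  Restricting to coordinates \<open>\<plusminus>(6 j + 1)\<close> with \<open>j < M\<close> and one negative sign disposes of the
  primes 2 and 3 and of the sign condition. The remaining bad tuples have three coordinates
  divisible by a common prime \<open>p \<ge> 5\<close>, so by the union bound there are at most
  \<open>4 M \<Sum>\<^sub>p (2 M / p)\<^sup>3 + O(M\<^sup>2)\<close> of them. Since \<open>\<Sum>\<^sub>p p\<^sup>-\<^sup>3\<close> over \<open>p \<ge> 5\<close> is below 1/40, this is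
  at most \<open>4/5 M\<^sup>4 + O(M\<^sup>2)\<close>, which leaves a positive proportion of all \<open>M\<^sup>4\<close> tuples.
\<close>

section \<open>Lattice points in boxes and an upper bound for \<open>L A\<close>\<close>

lemma card_vec_box:
  fixes F :: "'n::finite \<Rightarrow> 'a set"
  shows "card {v :: 'a ^ 'n. \<forall>i. v $ i \<in> F i} = (\<Prod>i\<in>UNIV. card (F i))"
proof -
  have "bij_betw vec_nth {v :: 'a ^ 'n. \<forall>i. v $ i \<in> F i} (PiE UNIV F)"
    by (rule bij_betwI[where g = vec_lambda]) auto
  then show ?thesis
    by (simp add: bij_betw_same_card card_PiE)
qed

lemma finite_vec_box:
  fixes F :: "'n::finite \<Rightarrow> 'a set"
  assumes "\<And>i. finite (F i)"
  shows "finite {v :: 'a ^ 'n. \<forall>i. v $ i \<in> F i}"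
proof -
  have "bij_betw vec_nth {v :: 'a ^ 'n. \<forall>i. v $ i \<in> F i} (PiE UNIV F)"
    by (rule bij_betwI[where g = vec_lambda]) auto
  then show ?thesis
    using assms by (simp add: bij_betw_finite finite_PiE)
qed

lemma card_L_le:
  assumes "A \<ge> 1"
  shows "real (card (L A)) \<le> (3 * A) ^ 4"
proof -
  let ?B = "{a :: int ^ 4. \<forall>i. a $ i \<in> {-\<lfloor>A\<rfloor>..\<lfloor>A\<rfloor>}}"
  have "L A \<subseteq> ?B"
  proof (intro subsetI CollectI allI)
    fix a :: "int ^ 4" and i :: 4
    assume "a \<in> L A"
    moreover have "\<bar>real_vec a $ i\<bar> \<le> norm (real_vec a)"
      by (rule component_le_norm_cart)
    ultimately have "\<bar>real_of_int (a $ i)\<bar> \<le> A"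
      by (simp add: L_def real_vec_def)
    then have "a $ i \<le> \<lfloor>A\<rfloor>" "- (a $ i) \<le> \<lfloor>A\<rfloor>"
      by (simp_all add: le_floor_iff)
    then show "a $ i \<in> {-\<lfloor>A\<rfloor>..\<lfloor>A\<rfloor>}"
      by simp
  qed
  then have "card (L A) \<le> card ?B"
    by (intro card_mono finite_vec_box) auto
  also have "card ?B = nat (2 * \<lfloor>A\<rfloor> + 1) ^ 4"
    unfolding card_vec_box by (simp add: add.commute power4_eq_xxxx)
  finally have "real (card (L A)) \<le> real (nat (2 * \<lfloor>A\<rfloor> + 1)) ^ 4"
    using of_nat_le_iff[where 'a = real] by fastforce
  also have "real (nat (2 * \<lfloor>A\<rfloor> + 1)) \<le> 3 * A"
    using assms by linarith
  then have "real (nat (2 * \<lfloor>A\<rfloor> + 1)) ^ 4 \<le> (3 * A) ^ 4"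
    by (intro power_mono) auto
  finally show ?thesis .
qed

section \<open>Solvability modulo a prime with two unit coefficients\<close>

text \<open>Set every variable except those at \<open>i\<close> and \<open>k\<close> to 1. A choice
  \<open>y\<close> at \<open>i\<close> forces the value at \<open>k\<close>, because
  \<open>a $ k\<close> is invertible, and this value is a unit exactly when
  \<open>s + a $ i * y\<close> is one. The values of that expression at \<open>y = 1\<close> and
  \<open>y = 2\<close> differ by the unit \<open>a $ i\<close>, so at least one of them is a unit.
  The bound \<open>p \<ge> 3\<close> keeps 2 itself a unit.\<close>

lemma solvable_mod_prime:
  fixes a :: "int ^ 'n" and p :: int
  assumes p: "prime p" "p \<ge> 3" and ik: "i \<noteq> k" "\<not> p dvd a $ i" "\<not> p dvd a $ k"
  shows "\<exists>x :: int ^ 'n. (\<forall>i. \<not> p dvd x $ i) \<and> [(\<Sum>i\<in>UNIV. a $ i * x $ i) = 0] (mod p)"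
proof -
  define s where "s = (\<Sum>j\<in>UNIV - {i, k}. a $ j)"
  obtain y where y: "y = 1 \<or> y = 2" "\<not> p dvd s + a $ i * y"
  proof (cases "p dvd s + a $ i * 1")
    case True
    have "\<not> p dvd s + a $ i * 2"
    proof
      assume "p dvd s + a $ i * 2"
      from dvd_diff[OF this True] show False using ik by simp
    qed
    then show ?thesis using that by blast
  qed (use that in blast)
  have y_unit: "\<not> p dvd y"
    using y p by (auto dest: zdvd_imp_le)
  have "coprime (a $ k) p"
    using p ik by (simp add: coprime_commute prime_imp_coprime)
  then obtain b where b: "[a $ k * b = 1] (mod p)"
    using cong_solve_coprime_int by blast
  define z where "z = - (b * (s + a $ i * y))"
  have "\<not> p dvd b"
    using b p by (metis cong_dvd_iff dvd_mult not_prime_unit)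
  then have z_unit: "\<not> p dvd z"
    using y p by (simp add: z_def prime_dvd_mult_iff)
  define x :: "int ^ 'n" where "x = (\<chi> j. if j = i then y else if j = k then z else 1)"
  have "(\<Sum>j\<in>UNIV. a $ j * x $ j) = a $ i * y + (a $ k * z + (\<Sum>j\<in>UNIV - {i} - {k}. a $ j * x $ j))"
    using ik by (simp add: sum.remove[of UNIV i] sum.remove[of "UNIV - {i}" k] x_def)
  also have "(\<Sum>j\<in>UNIV - {i} - {k}. a $ j * x $ j) = s"
    unfolding s_def by (rule sum.cong) (auto simp: x_def)
  \<comment> \<open>The factor \<open>1 - a $ k * b\<close> vanishes modulo \<open>p\<close> by the
    choice of \<open>b\<close> as an inverse of \<open>a $ k\<close>.\<close>
  also have "a $ i * y + (a $ k * z + s) = (s + a $ i * y) * (1 - a $ k * b)"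
    by (simp add: z_def algebra_simps)
  also have "[\<dots> = (s + a $ i * y) * (1 - 1)] (mod p)"
    by (intro cong_mult cong_diff cong_refl b)
  finally have "[(\<Sum>j\<in>UNIV. a $ j * x $ j) = 0] (mod p)"
    by simp
  moreover have "\<forall>j. \<not> p dvd x $ j"
    using y_unit z_unit p by (auto simp: x_def dest: zdvd_imp_le)
  ultimately show ?thesis by blast
qed

section \<open>The test vectors and their local solvability\<close>

definition signed_vec :: "nat ^ 4 \<Rightarrow> int ^ 4" where
  "signed_vec j = (\<chi> i. if i = 1 then - (6 * int (j $ i) + 1) else 6 * int (j $ i) + 1)"

lemma inj_signed_vec: "inj signed_vec"
proof (rule injI)
  fix j j' assume eq: "signed_vec j = signed_vec j'"
  have "j $ i = j' $ i" for i
    using arg_cong[OF eq, of "\<lambda>v. v $ i"] by (auto simp: signed_vec_def split: if_splits)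
  then show "j = j'" by (simp add: vec_eq_iff)
qed

lemma dvd_signed_vec_iff: "int p dvd signed_vec j $ i \<longleftrightarrow> p dvd 6 * j $ i + 1"
proof -
  have "int p dvd signed_vec j $ i \<longleftrightarrow> int p dvd int (6 * j $ i + 1)"
    using dvd_minus_iff[of "int p" "6 * int (j $ i) + 1"]
    by (cases "i = 1") (simp_all add: signed_vec_def add.commute)
  then show ?thesis by (simp only: of_nat_dvd_iff)
qed

lemma norm_signed_vec_le:
  assumes "\<And>i. j $ i < M"
  shows "norm (real_vec (signed_vec j)) \<le> 24 * real M"
proof -
  have "norm (real_vec (signed_vec j)) \<le> (\<Sum>i\<in>UNIV. \<bar>real_vec (signed_vec j) $ i\<bar>)"
    by (rule norm_le_l1_cart)
  also have "\<dots> \<le> (\<Sum>i\<in>(UNIV :: 4 set). 6 * real M)"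
  proof (rule sum_mono)
    fix i :: 4
    have "real (j $ i) + 1 \<le> real M"
      using assms[of i] by linarith
    then show "\<bar>real_vec (signed_vec j) $ i\<bar> \<le> 6 * real M"
      by (cases "i = 1") (simp_all add: real_vec_def signed_vec_def)
  qed
  finally show ?thesis by simp
qed

text \<open>Coordinate \<open>k\<close> is left unconstrained: the union over \<open>k\<close> is
  then the set of tuples with at most one unit entry modulo \<open>p\<close>, and each single set is
  a product box that can be counted exactly.\<close>

definition bad_at :: "nat \<Rightarrow> nat \<Rightarrow> 4 \<Rightarrow> (nat ^ 4) set" where
  "bad_at M p k = {j. (\<forall>i. j $ i < M) \<and> (\<forall>i. i \<noteq> k \<longrightarrow> p dvd 6 * j $ i + 1)}"

lemma prime_dvd_6_mult_plus_1:
  assumes "prime (p::nat)" "p dvd 6 * j + 1"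
  shows "p \<ge> 5" "coprime p 6"
proof -
  have "\<not> p dvd 6"
  proof
    assume "p dvd 6"
    then have "p dvd 6 * j" by simp
    with assms(2) have "p dvd 1" using dvd_add_right_iff by blast
    with assms(1) show False by simp
  qed
  with assms(1) show "coprime p 6" by (simp add: prime_imp_coprime)
  have "p \<noteq> 2" "p \<noteq> 3" "p \<noteq> 4" using \<open>\<not> p dvd 6\<close> assms(1) by auto
  with prime_ge_2_nat[OF assms(1)] show "p \<ge> 5" by linarith
qed

text \<open>The finite range for \<open>p\<close> is enough, since a prime dividing some
  \<open>6 * j $ i + 1\<close> with \<open>j $ i < M\<close> lies between 5 and
  \<open>6 * M\<close>. Hence every prime leaves two entries as units, which yields both primitivity
  and solvability at odd primes.\<close>

lemma signed_vec_in_Lloc: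
  assumes j: "\<And>i. j $ i < M"
    and good: "\<And>p k. prime p \<Longrightarrow> p \<in> {5..6 * M} \<Longrightarrow> j \<notin> bad_at M p k"
    and M: "24 * real M \<le> A"
  shows "signed_vec j \<in> Lloc A"
proof -
  have two_units: "\<exists>i k. i \<noteq> k \<and> \<not> int p dvd signed_vec j $ i \<and> \<not> int p dvd signed_vec j $ k"
    if p: "prime p" for p
  proof (rule ccontr)
    assume no_pair: "\<not> ?thesis"
    \<comment> \<open>Without a pair of unit entries there is at most one; \<open>k\<close> is its
      position, or arbitrary if there is none.\<close>
    obtain k where k: "\<forall>i. i \<noteq> k \<longrightarrow> p dvd 6 * j $ i + 1"
      using no_pair unfolding dvd_signed_vec_iff by metis
    obtain i :: 4 where i: "i \<noteq> k"
      by (metis zero_neq_one)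
    have "p dvd 6 * j $ i + 1" using k i by blast
    then have "5 \<le> p" "p \<le> 6 * j $ i + 1"
      using prime_dvd_6_mult_plus_1[OF p] by (auto intro: dvd_imp_le)
    moreover have "6 * j $ i + 1 \<le> 6 * M" using j[of i] by linarith
    ultimately have "j \<in> bad_at M p k" "p \<in> {5..6 * M}"
      using j k by (auto simp: bad_at_def)
    with good p show False by blast
  qed
  have nonzero: "signed_vec j $ i \<noteq> 0" for i
    by (simp add: signed_vec_def)
  have "(GCD i. signed_vec j $ i) = 1"
  proof (rule ccontr)
    assume "(GCD i. signed_vec j $ i) \<noteq> 1"
    then have "nat (GCD i. signed_vec j $ i) \<noteq> 1"
      by linarith
    then obtain p where p: "prime p" "p dvd nat (GCD i. signed_vec j $ i)"
      using prime_factor_nat by blast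
    have "Gcd (range (($) (signed_vec j))) \<ge> 0"
      by (rule Gcd_int_greater_eq_0)
    then have "int p dvd (GCD i. signed_vec j $ i)"
      using p(2) by (metis int_dvd_int_iff nat_0_le)
    then have "int p dvd signed_vec j $ i" for i
      by (rule dvd_trans) (simp add: Gcd_dvd)
    with two_units[OF p(1)] show False by blast
  qed
  then have "signed_vec j \<in> Z4prim"
    using nonzero by (simp add: Z4prim_def)
  moreover have "\<exists>x :: int ^ 4. (\<forall>i. \<not> q dvd x $ i) \<and> [(\<Sum>i\<in>UNIV. signed_vec j $ i * x $ i) = 0] (mod q)"
    if q: "prime q" for q :: int
  proof (cases "q = 2")
    case True
    \<comment> \<open>At 2 all four entries are odd, so the all-ones vector is a solution.\<close>
    have "even (\<Sum>i\<in>UNIV. signed_vec j $ i * 1)"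
      by (simp add: sum_4 signed_vec_def)
    then show ?thesis
      by (intro exI[of _ "\<chi> i. 1"]) (simp add: True cong_0_iff)
  next
    case False
    then have "q \<ge> 3" using prime_ge_2_int[OF q] by linarith
    moreover obtain p where "q = int p" "prime p"
      using q by (metis int_nat_eq prime_ge_0_int prime_nat_iff_prime)
    ultimately show ?thesis
      using two_units[of p] q solvable_mod_prime[of q] by blast
  qed
  moreover have "signed_vec j $ 1 < 0" "signed_vec j $ 2 > 0"
    by (simp_all add: signed_vec_def)
  then have "\<not> ((\<forall>i. signed_vec j $ i > 0) \<or> (\<forall>i. signed_vec j $ i < 0))"
    by (meson less_asym)
  ultimately show ?thesis
    using norm_signed_vec_le[OF j] M by (auto simp: Lloc_def locally_solvable_def)
qed

section \<open>Counting the bad tuples\<close>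

text \<open>The solutions \<open>j\<close> lie in a single residue class modulo \<open>p\<close>, so
  each is determined by its quotient \<open>j div p\<close>.\<close>

lemma card_dvd_6_mult_plus_1_le:
  assumes p: "prime p"
  shows "card {j. j < M \<and> p dvd 6 * j + 1} \<le> (M - 1) div p + 1"
proof -
  let ?S = "{j. j < M \<and> p dvd 6 * j + 1}"
  have "inj_on (\<lambda>j. j div p) ?S"
  proof (rule inj_onI)
    fix x y assume x: "x \<in> ?S" and y: "y \<in> ?S" and eq: "x div p = y div p"
    have "[6 * x + 1 = 6 * y + 1] (mod p)"
      using x y by (simp add: cong_def mod_eq_0_iff_dvd)
    then have "[6 * x = 6 * y] (mod p)"
      by (simp only: cong_add_rcancel_nat)
    \<comment> \<open>The member \<open>x\<close> rules out the primes 2 and 3, for which the set is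
      empty.\<close>
    moreover have "coprime 6 p"
      using prime_dvd_6_mult_plus_1(2)[OF p] x by (auto simp: coprime_commute)
    ultimately have "x mod p = y mod p"
      by (simp add: cong_mult_lcancel_nat cong_def[symmetric])
    with eq show "x = y" by (metis div_mult_mod_eq)
  qed
  then have "card ?S \<le> card {..(M - 1) div p}"
    by (rule card_inj_on_le) (auto intro!: div_le_mono)
  then show ?thesis by simp
qed

text \<open>For \<open>p \<le> M\<close> the count is at most \<open>2 * M / p\<close>, and
  \<open>p ^ 3\<close> is lowered to \<open>(p - 1) * p * (p + 1)\<close> to make the later sum
  telescope. For \<open>p > M\<close> the count is at most 1, which the summand \<open>+ 1\<close>
  absorbs.\<close>

lemma card_dvd_6_mult_plus_1_cube_le:
  assumes p: "prime p" "p \<ge> 5"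
  shows "real (card {j. j < M \<and> p dvd 6 * j + 1}) ^ 3 \<le>
    8 * real M ^ 3 * (1 / ((real p - 1) * real p * (real p + 1))) + 1"
proof (cases "p \<le> M")
  case True
  have "real (card {j. j < M \<and> p dvd 6 * j + 1}) \<le> real ((M - 1) div p + 1)"
    using card_dvd_6_mult_plus_1_le[OF p(1)] of_nat_mono by blast
  also have "\<dots> \<le> real M / real p + 1"
  proof -
    have "real ((M - 1) div p) \<le> real (M - 1) / real p" 
      by (rule of_nat_div_le_of_nat)
    also have "\<dots> \<le> real M / real p" by (intro divide_right_mono) auto
    finally show ?thesis by simp
  qed
  also have "\<dots> \<le> 2 * (real M / real p)"
    using True p by (simp add: field_simps)
  finally have "real (card {j. j < M \<and> p dvd 6 * j + 1}) ^ 3 \<le> (2 * (real M / real p)) ^ 3"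
    by (intro power_mono) auto
  also have "\<dots> = 8 * real M ^ 3 * (1 / real p ^ 3)"
    by (simp add: power_mult_distrib power_divide)
  also have "\<dots> \<le> 8 * real M ^ 3 * (1 / ((real p - 1) * real p * (real p + 1)))"
  proof (intro mult_left_mono divide_left_mono)
    show "(real p - 1) * real p * (real p + 1) \<le> real p ^ 3"
      by (simp add: algebra_simps power3_eq_cube)
  qed (use p in auto)
  finally show ?thesis by simp
next
  case False
  then have "(M - 1) div p = 0" by simp
  with card_dvd_6_mult_plus_1_le[OF p(1), of M]
  have "card {j. j < M \<and> p dvd 6 * j + 1} \<le> 1" by simp
  then have "real (card {j. j < M \<and> p dvd 6 * j + 1}) ^ 3 \<le> 1"
    by (intro power_le_one) auto
  moreover have "0 \<le> 8 * real M ^ 3 * (1 / ((real p - 1) * real p * (real p + 1)))"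
    using p by simp
  ultimately show ?thesis by linarith
qed

text \<open>Each term is half the difference of \<open>1 / ((p - 1) * p)\<close> and
  \<open>1 / (p * (p + 1))\<close>, so the sum telescopes from
  \<open>1 / (2 * 4 * 5) = 1 / 40\<close>.\<close>

lemma sum_inverse_consecutive_products:
  "(\<Sum>p = 5..n. 1 / ((real p - 1) * real p * (real p + 1))) \<le> 1 / 40"
proof -
  have "(\<Sum>p = 5..n. 1 / ((real p - 1) * real p * (real p + 1))) = 1 / 40 - 1 / (2 * real n * (real n + 1))"
    if "n \<ge> 5" for n
    using that
  proof (induction n rule: dec_induct)
    case base
    then show ?case by simp
  next
    case (step n)
    have "1 / 40 - 1 / (2 * x * (x + 1)) + 1 / ((x + 1 - 1) * (x + 1) * (x + 1 + 1))
        = 1 / 40 - 1 / (2 * (x + 1) * (x + 1 + 1))" if "x > 0" for x :: real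
      using that by (simp add: divide_simps) (simp add: algebra_simps)
    from this[of "real n"] step show ?case
      by (simp add: add.commute)
  qed
  then show ?thesis by (cases "n \<ge> 5") auto
qed

lemma card_bad_at: "card (bad_at M p k) = M * card {j. j < M \<and> p dvd 6 * j + 1} ^ 3"
proof -
  let ?F = "\<lambda>i. if i = k then {..<M} else {j. j < M \<and> p dvd 6 * j + 1}"
  have "bad_at M p k = {j. \<forall>i. j $ i \<in> ?F i}"
    by (auto simp: bad_at_def)
  then have "card (bad_at M p k) = (\<Prod>i\<in>UNIV. card (?F i))"
    by (simp only: card_vec_box)
  also have "\<dots> = card (?F k) * (\<Prod>i\<in>UNIV - {k}. card (?F i))"
    by (rule prod.remove) auto
  also have "(\<Prod>i\<in>UNIV - {k}. card (?F i)) = (\<Prod>i\<in>UNIV - {k}. card {j. j < M \<and> p dvd 6 * j + 1})"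
    by (rule prod.cong) auto
  finally show ?thesis by (simp add: card_Diff_singleton)
qed

section \<open>The lower bound for \<open>Lloc A\<close> and the density\<close>

lemma card_Lloc_ge:
  assumes M: "24 * real M \<le> A"
  shows "real M ^ 4 / 5 - 24 * real M ^ 2 \<le> real (card (Lloc A))"
proof -
  define J where "J = {j :: nat ^ 4. \<forall>i. j $ i \<in> {..<M}}"
  define P where "P = {p \<in> {5..6 * M}. prime p}"
  define B where "B = (\<Union>k. \<Union>p\<in>P. bad_at M p k)"
  have fin_J: "finite J"
    unfolding J_def by (intro finite_vec_box) auto
  have card_J: "card J = M ^ 4"
    unfolding J_def card_vec_box by simp
  have B_J: "B \<subseteq> J"
    by (auto simp: B_def J_def bad_at_def)
  have fin_P: "finite P"
    by (simp add: P_def)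
  have "card B \<le> (\<Sum>k\<in>UNIV. card (\<Union>p\<in>P. bad_at M p k))"
    unfolding B_def by (rule card_UN_le) simp
  also have "\<dots> \<le> (\<Sum>k\<in>(UNIV :: 4 set). \<Sum>p\<in>P. card (bad_at M p k))"
    by (intro sum_mono card_UN_le fin_P)
  also have "\<dots> = 4 * (M * (\<Sum>p\<in>P. card {j. j < M \<and> p dvd 6 * j + 1} ^ 3))"
    by (simp add: card_bad_at sum_distrib_left)
  finally have "real (card B) \<le> real (4 * (M * (\<Sum>p\<in>P. card {j. j < M \<and> p dvd 6 * j + 1} ^ 3)))"
    by (rule of_nat_mono)
  also have "\<dots> = 4 * (real M * (\<Sum>p\<in>P. real (card {j. j < M \<and> p dvd 6 * j + 1}) ^ 3))"
    by simp
  \<comment> \<open>The first summand comes from the telescoping sum, the second from at most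
    \<open>6 * M\<close> error terms of size 1. With the four positions of \<open>k\<close> the main
    term becomes \<open>4 * 8 / 40 = 4 / 5\<close>, strictly below 1.\<close>
  also have "\<dots> \<le> 4 * (real M * (8 * real M ^ 3 * (1 / 40) + 6 * real M))"
  proof (intro mult_left_mono)
    let ?t = "\<lambda>p. 8 * real M ^ 3 * (1 / ((real p - 1) * real p * (real p + 1))) + 1"
    have "(\<Sum>p\<in>P. real (card {j. j < M \<and> p dvd 6 * j + 1}) ^ 3) \<le> (\<Sum>p\<in>P. ?t p)"
      by (intro sum_mono card_dvd_6_mult_plus_1_cube_le) (auto simp: P_def)
    \<comment> \<open>The sum passes from primes to all integers, as the terms are
      nonnegative.\<close>
    also have "\<dots> \<le> (\<Sum>p = 5..6 * M. ?t p)"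
      by (intro sum_mono2) (auto simp: P_def)
    also have "\<dots> = 8 * real M ^ 3 * (\<Sum>p = 5..6 * M. 1 / ((real p - 1) * real p * (real p + 1)))
        + real (6 * M + 1 - 5)"
      by (simp only: sum.distrib sum_distrib_left[symmetric]) simp
    also have "\<dots> \<le> 8 * real M ^ 3 * (1 / 40) + 6 * real M"
      by (intro add_mono mult_left_mono sum_inverse_consecutive_products) auto
    finally show "(\<Sum>p\<in>P. real (card {j. j < M \<and> p dvd 6 * j + 1}) ^ 3)
        \<le> 8 * real M ^ 3 * (1 / 40) + 6 * real M" .
  qed auto
  also have "\<dots> = real M ^ 4 * (4 / 5) + 24 * real M ^ 2"
    by (simp add: algebra_simps power2_eq_square power3_eq_cube power4_eq_xxxx)
  finally have card_B: "real (card B) \<le> real M ^ 4 * (4 / 5) + 24 * real M ^ 2" .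
  have "signed_vec ` (J - B) \<subseteq> Lloc A"
    using M by (auto simp: J_def B_def P_def intro!: signed_vec_in_Lloc)
  moreover have "finite (Lloc A)"
    using Lloc_subset_L finite_L by (rule finite_subset)
  ultimately have "card (signed_vec ` (J - B)) \<le> card (Lloc A)"
    by (intro card_mono)
  also have "card (signed_vec ` (J - B)) = card J - card B"
    using inj_signed_vec B_J fin_J
    by (simp add: card_image inj_on_subset card_Diff_subset finite_subset)
  finally have "real (card J) - real (card B) \<le> real (card (Lloc A))"
    by linarith
  with card_J card_B show ?thesis by simp
qed

theorem theorem1p2:
  "Liminf at_top (\<lambda>A::real. ereal (real (card (Lloc A)) / real (card (L A)))) > 0"
proof -
  \<comment> \<open>Here \<open>144 = 48 * 3\<close> combines \<open>A / 48 \<le> M\<close> with the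
    bound \<open>(3 * A) ^ 4\<close> for \<open>L A\<close>; the 10 arises from giving up half of
    \<open>M ^ 4 / 5\<close> to the quadratic error.\<close>
  define c :: real where "c = (1 / 144) ^ 4 / 10"
  \<comment> \<open>The threshold ensures \<open>M \<ge> 16\<close>, so that
    \<open>M ^ 2 \<ge> 240\<close> and thus \<open>24 * M ^ 2 \<le> M ^ 4 / 10\<close>.\<close>
  have "c \<le> real (card (Lloc A)) / real (card (L A))" if A: "A \<ge> 24 * 16" for A
  proof -
    define M where "M = nat \<lfloor>A / 24\<rfloor>"
    have M: "24 * real M \<le> A" "A \<le> 48 * real M" "real M \<ge> 16"
      using A unfolding M_def by (simp_all add: nat_le_iff) linarith+
    have "16 ^ 2 \<le> real M ^ 2"
      using M by (intro power_mono) auto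
    then have "240 * real M ^ 2 \<le> real M ^ 2 * real M ^ 2"
      by (intro mult_right_mono) auto
    also have "\<dots> = real M ^ 4"
      by (simp flip: power_add)
    finally have "real M ^ 4 / 10 \<le> real M ^ 4 / 5 - 24 * real M ^ 2"
      by simp
    also have "\<dots> \<le> real (card (Lloc A))"
      by (rule card_Lloc_ge[OF M(1)])
    finally have lower: "real M ^ 4 / 10 \<le> real (card (Lloc A))" .
    have "real M ^ 4 > 0"
      using M by simp
    with lower have "card (Lloc A) > 0"
      by (cases "card (Lloc A) = 0") auto
    \<comment> \<open>Positivity excludes the default value 0 of a division by zero.\<close>
    then have pos: "real (card (L A)) > 0"
      using card_mono[OF finite_L Lloc_subset_L, of A] by linarith
    have "(A / 48) ^ 4 \<le> real M ^ 4"
      using M A by (intro power_mono) auto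
    moreover have "(A / 48) ^ 4 / 10 = c * (3 * A) ^ 4"
      by (simp add: c_def power_mult_distrib power_divide)
    moreover have "c * real (card (L A)) \<le> c * (3 * A) ^ 4"
      using A by (intro mult_left_mono card_L_le) (auto simp: c_def)
    ultimately have "c * real (card (L A)) \<le> real (card (Lloc A))"
      using lower by linarith
    with pos show ?thesis by (simp add: pos_le_divide_eq)
  qed
  then have "eventually (\<lambda>A. ereal c \<le> ereal (real (card (Lloc A)) / real (card (L A)))) at_top"
    by (auto simp: eventually_at_top_linorder)
  then have "ereal c \<le> Liminf at_top (\<lambda>A::real. ereal (real (card (Lloc A)) / real (card (L A))))"
    by (rule Liminf_bounded)
  moreover have "ereal c > 0"
    by (simp add: c_def)
  ultimately show ?thesis by (rule less_le_trans[rotated])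
qed

end
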